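(* (i) Let $m>1$ be an odd integer and $a\in\{0,1,2,\ldots\}$. If $r$ is a positive integer such that $2r$ is a quadratic residue modulo $m$, then there are infinitely many positive integers $n$ not of the form $n=(2^ap-r)/m^2+T_x$ with $p$ a prime and $x\in\mathbb{Z}$. Consequently, the set $S^{(a)}_{m^2}=\{n>m^2:\ \gcd(m^2,n)=1 \text{ and } n\neq 2^ap+m^2T_x \text{ for every prime } p \text{ and every } x\in\mathbb{Z}\}$ is infinite. (ii) Let $m=2^{\alpha}m_0$ be a positive even integer with $\alpha,m_0$ positive integers and $m_0$ odd. If $r$ is a positive integer which is a quadratic residue modulo $m_0$ and satisfies $r\equiv 2^{\alpha}+1\pmod{2^{\min\{\alpha+1,3\}}}$, then there are infinitely many positive integers $n$ not of the form $n=(p-r)/(2m^2)+T_x$ with $p$ a prime and $x\in\mathbb{Z}$. Consequently, the set $S_{2m^2}=\{n>2m^2:\ \gcd(2m^2,n)=1 \text{ and } n\neq p+2m^2T_x \text{ for every prime } p \text{ and every } x\in\mathbb{Z}\}$ is infinite.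
   Context: For $x\in\mathbb{Z}$, $T_x=x(x+1)/2$ denotes the $x$-th triangular number. An integer $r$ is a quadratic residue modulo $m$ if $r\equiv y^2\pmod m$ for some integer $y$ coprime to $m$ (for $m_0=1$ every integer counts as a quadratic residue). *)

theory Defs
  imports "HOL-Number_Theory.Number_Theory"
begin

definition triangular :: "int \<Rightarrow> int" where
  "triangular x = x * (x + 1) div 2"

text \<open>Unlike the library's \<^const>\<open>QuadRes\<close>, a quadratic residue is required to be the
  square of a unit modulo \<open>m\<close>.\<close>

definition quad_residue :: "int \<Rightarrow> int \<Rightarrow> bool" where
  "quad_residue m r \<longleftrightarrow> (\<exists>y. coprime y m \<and> [r = y\<^sup>2] (mod m))"

lemma quad_residue_1: "quad_residue 1 r"
  by (auto simp: quad_residue_def)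

end

theory Submission
  imports Defs
begin

text \<open>
  Multiplying \<open>m\<^sup>2 n + r = 2\<^sup>a p + m\<^sup>2 T\<^sub>x\<close> by 8 gives
  \<open>2\<^bsup>a+3\<^esup> p = (8 r + m\<^sup>2 (8 n + 1)) - (m (2 x + 1))\<^sup>2\<close>. The residue condition on \<open>r\<close> allows
  infinitely many \<open>n\<close> for which \<open>8 r + m\<^sup>2 (8 n + 1)\<close> is a square \<open>k\<^sup>2\<close>, where \<open>k\<close> runs through an
  arithmetic progression. Then \<open>2\<^bsup>a+1\<^esup> p = X Y\<close> with \<open>X + Y = k\<close> odd, so the odd one among
  \<open>X, Y\<close> is \<open>1\<close> or \<open>p\<close>, i.e. \<open>p = (k - 1) / 2\<^bsup>a+1\<^esup>\<close> or \<open>p = k - 2\<^bsup>a+1\<^esup>\<close>. Both are excluded by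
  choosing \<open>k \<equiv> 1\<close> modulo \<open>2\<^bsup>a+3\<^esup>\<close> with \<open>k - 2\<^bsup>a+1\<^esup>\<close> composite. In part (ii), with \<open>M = m / 2\<close>,
  the equation becomes \<open>p = K\<^sup>2 - (M (2 x + 1))\<^sup>2\<close> with \<open>K\<^sup>2 = r + M\<^sup>2 (8 n + 1)\<close>, which forces
  \<open>p = 2 K - 1\<close>; again \<open>K\<close> runs through an arithmetic progression on which this is composite.
\<close>

section \<open>Triangular numbers and unbounded sets of integers\<close>

lemma eight_triangular: "8 * triangular x = (2 * x + 1)\<^sup>2 - 1"
proof -
  have "2 * triangular x = x * (x + 1)"
    unfolding triangular_def by simp
  thus ?thesis
    by (simp add: power2_eq_square algebra_simps)
qed

lemma infinite_int_if_unbounded: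
  fixes S :: "int set"
  assumes "\<And>b. \<exists>n\<in>S. n > b"
  shows "infinite S"
proof
  assume "finite S"
  obtain n where "n \<in> S" "n > Max S"
    using assms by blast
  with \<open>finite S\<close> show False
    using Max_ge by fastforce
qed

lemma odd_square_cong_1_mod_8:
  fixes k :: int
  assumes "odd k"
  shows "[k\<^sup>2 = 1] (mod 8)"
proof -
  obtain j where j: "k = 2 * j + 1"
    using assms by (elim oddE)
  have "k\<^sup>2 - 1 = 8 * triangular j"
    by (simp add: eight_triangular j)
  thus ?thesis
    by (simp add: cong_iff_dvd_diff)
qed

section \<open>Lifting square roots to higher moduli\<close>

text \<open>One Newton step: since \<open>m\<close> is odd and \<open>y\<close> is a unit,
  \<open>2 * y\<close> has an inverse \<open>z\<close> modulo \<open>m\<close>, and adding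
  \<open>m * z * e\<close> to \<open>y\<close> cancels the error \<open>m * e\<close> up to
  multiples of \<open>m^2\<close>.\<close>

lemma quad_residue_lift_square:
  assumes "odd m" "quad_residue m c"
  shows "\<exists>y. [y\<^sup>2 = c] (mod m\<^sup>2)"
proof -
  obtain y where y: "coprime y m" "[c = y\<^sup>2] (mod m)"
    using assms unfolding quad_residue_def by auto
  from y(2) obtain e where e: "c - y\<^sup>2 = m * e"
    unfolding cong_iff_dvd_diff by (elim dvdE)
  have "coprime (2 * y) m"
    using assms y by simp
  then obtain z where z: "[2 * y * z = 1] (mod m)"
    using cong_solve_coprime_int by blast
  then obtain w where w: "2 * y * z - 1 = m * w"
    unfolding cong_iff_dvd_diff by (elim dvdE)
  have "(y + m * (z * e))\<^sup>2 - c = m * e * (2 * y * z - 1) + m\<^sup>2 * (z * e)\<^sup>2"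
    using e by (simp add: power2_eq_square algebra_simps)
  also have "\<dots> = m\<^sup>2 * (e * w + (z * e)\<^sup>2)"
    unfolding w by (simp add: power2_eq_square algebra_simps)
  finally show ?thesis
    unfolding cong_iff_dvd_diff by (metis dvd_triv_left)
qed

lemma square_mod_power_of_2:
  fixes c :: int
  assumes "[c = 1] (mod 8)"
  shows "\<exists>y. odd y \<and> [y\<^sup>2 = c] (mod 2 ^ (k + 3))"
proof (induction k)
  case 0
  show ?case
    using assms by (intro exI[of _ 1]) (auto simp: cong_sym)
next
  case (Suc k)
  then obtain y e where y: "odd y" "y\<^sup>2 - c = 2 ^ (k + 3) * e"
    unfolding cong_iff_dvd_diff by (elim exE conjE dvdE)
  show ?case
  proof (cases "even e")
    case True
    then obtain f where "e = 2 * f" ..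
    with y have "y\<^sup>2 - c = 2 ^ (Suc k + 3) * f"
      by (simp add: power_add)
    with y(1) show ?thesis
      unfolding cong_iff_dvd_diff by (metis dvd_triv_left)
  next
    case False
    with y(1) have "even (e + y)"
      by simp
    then obtain f where f: "e + y = 2 * f" ..
    define h :: int where "h = 2 ^ k"
    \<comment> \<open>The root moves by \<open>4 * h = 2 ^ (k + 2)\<close>, so its square changes by
      an odd multiple of \<open>2 ^ (k + 3)\<close>, which pairs with the odd multiple
      \<open>e\<close> to an even one.\<close>
    have "(y + 4 * h)\<^sup>2 - c = 8 * h * (e + y) + 16 * h\<^sup>2"
      using y(2) by (simp add: power2_eq_square algebra_simps h_def power_add)
    also have "\<dots> = 2 ^ (Suc k + 3) * (f + h)"
      unfolding f by (simp add: power2_eq_square algebra_simps h_def power_add)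
    finally have "[(y + 4 * h)\<^sup>2 = c] (mod 2 ^ (Suc k + 3))"
      unfolding cong_iff_dvd_diff by simp
    moreover have "odd (y + 4 * h)"
      using y(1) by simp
    ultimately show ?thesis
      by blast
  qed
qed

section \<open>Large representatives and factorizations\<close>

lemma cong_large_representative:
  fixes k D L :: int
  assumes "D > 0"
  shows "\<exists>k'. [k' = k] (mod D) \<and> k' > L"
proof (intro exI conjI)
  define t where "t = \<bar>k\<bar> + \<bar>L\<bar> + 1"
  have "1 * t \<le> D * t"
    using assms by (intro mult_right_mono) (auto simp: t_def)
  moreover have "k + t > L"
    unfolding t_def by linarith
  ultimately show "k + D * t > L"
    by linarith
  show "[k + D * t = k] (mod D)"
    by (simp add: cong_iff_dvd_diff)
qed

lemma not_prime_mult_int: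
  fixes a b :: int
  assumes "a > 1" "b > 1"
  shows "\<not> prime (a * b)"
proof
  assume "prime (a * b)"
  hence "a = 1 \<or> a = a * b"
    using assms(1) unfolding prime_int_iff
    by (meson dvd_triv_left less_imp_le order.strict_trans zero_less_one)
  with assms show False
    by auto
qed

lemma pos_factors_if_pos_sum:
  fixes X Y :: int
  assumes "X + Y > 0" "X * Y > 0"
  shows "X > 0" "Y > 0"
  using assms by (auto simp: zero_less_mult_iff)

text \<open>An odd \<open>X\<close> must divide \<open>p\<close>, so it is 1 or \<open>p\<close>.
  The congruence on \<open>X + Y\<close> rules out the first case, the compositeness assumption the
  second.\<close>

lemma no_prime_factorization_odd:
  fixes X Y p :: int
  assumes "prime p" and XY: "X * Y = 2 ^ (a + 1) * p" and "X + Y > 0" "odd X"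
    and dvd: "2 ^ (a + 3) dvd X + Y - 1" and np: "\<not> prime (X + Y - 2 ^ (a + 1))"
  shows False
proof -
  have "X * Y > 0"
    using XY prime_gt_0_int[OF \<open>prime p\<close>] by simp
  hence "X > 0"
    using pos_factors_if_pos_sum assms(3) by blast
  have "coprime X (2 ^ (a + 1))"
    using \<open>odd X\<close> by simp
  moreover have "X dvd 2 ^ (a + 1) * p"
    using XY by (metis dvd_triv_left)
  ultimately have "X dvd p"
    using coprime_dvd_mult_right_iff by blast
  with \<open>prime p\<close> \<open>X > 0\<close> consider "X = 1" | "X = p"
    unfolding prime_int_iff using less_imp_le by blast
  thus False
  proof cases
    case 1
    \<comment> \<open>Here \<open>Y = X + Y - 1\<close> is a multiple of \<open>2 ^ (a + 3)\<close>,
      so \<open>p\<close> is a multiple of 4; the exponent \<open>a + 2\<close> would still allow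
      \<open>p = 2\<close>.\<close>
    then obtain q where "2 ^ (a + 1) * p = 2 ^ (a + 3) * q"
      using dvd XY by auto
    hence "p = 2 * (2 * q)"
      by (simp add: power_add)
    moreover have "\<not> prime (2 * (2 * q))"
      using calculation prime_gt_0_int[OF \<open>prime p\<close>] by (intro not_prime_mult_int) auto
    ultimately show False
      using \<open>prime p\<close> by simp
  next
    case 2
    with XY \<open>X > 0\<close> have "Y = 2 ^ (a + 1)"
      by simp
    with 2 np \<open>prime p\<close> show False
      by simp
  qed
qed

section \<open>Unrepresented integers for an odd modulus\<close>

lemma unrepresented_unbounded_odd:
  fixes m r y b :: int
  assumes "odd m" and y: "[y\<^sup>2 = 8 * r] (mod m\<^sup>2)"
  shows "\<exists>n>b. \<forall>p x. prime p \<longrightarrow> m\<^sup>2 * n + r \<noteq> 2 ^ a * p + m\<^sup>2 * triangular x"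
proof -
  define D :: int where "D = m\<^sup>2 * 2 ^ (a + 3)"
  have "m \<noteq> 0"
    using \<open>odd m\<close> by auto
  hence D: "D > 0"
    unfolding D_def by simp
  have "coprime (m\<^sup>2) (2 ^ (a + 3))"
    using \<open>odd m\<close> by simp
  then obtain k0 where k0: "[k0 = y] (mod m\<^sup>2)" "[k0 = 1] (mod 2 ^ (a + 3))"
    using binary_chinese_remainder_int by blast
  \<comment> \<open>The power of 2 in the bound makes \<open>c > 1\<close> below; the absolute value
    makes \<open>k\<close>, hence \<open>k^2\<close>, large enough to force
    \<open>n > b\<close>.\<close>
  define L where "L = 2 ^ (a + 1) + 1 + \<bar>8 * r + m\<^sup>2 * (8 * b + 1)\<bar>"
  obtain k1 where k1: "[k1 = k0] (mod D)" "k1 > L"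
    using cong_large_representative[OF D] by blast
  define c where "c = k1 - 2 ^ (a + 1)"
  \<comment> \<open>The shift by a multiple of \<open>D\<close> keeps all congruences and turns
    \<open>k - 2 ^ (a + 1)\<close> into the proper product \<open>c * (D + 1)\<close>.\<close>
  define k where "k = k1 + D * c"
  have "c > 1"
    using k1(2) unfolding c_def L_def by linarith
  have kL: "k > L"
    unfolding k_def using k1(2) mult_pos_pos[of D c] D \<open>c > 1\<close> by linarith
  hence "k > 0"
    unfolding L_def by (smt (verit) zero_less_power)
  have "k - 2 ^ (a + 1) = c * (D + 1)"
    unfolding k_def c_def by (simp add: algebra_simps)
  hence np: "\<not> prime (k - 2 ^ (a + 1))"
    using not_prime_mult_int[of c "D + 1"] D \<open>c > 1\<close> by simp
  have "[k = k1] (mod D)"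
    by (simp add: cong_iff_dvd_diff k_def)
  with k1(1) have kD: "[k = k0] (mod D)"
    using cong_trans by blast
  have "[k = k0] (mod m\<^sup>2)"
    using kD unfolding D_def by (rule cong_modulus_mult)
  with k0(1) have "[k\<^sup>2 = y\<^sup>2] (mod m\<^sup>2)"
    using cong_trans cong_pow by blast
  with y have k8r: "[k\<^sup>2 = 8 * r] (mod m\<^sup>2)"
    using cong_trans by blast
  have "[k = k0] (mod 2 ^ (a + 3))"
    using kD unfolding D_def by (metis cong_modulus_mult mult.commute)
  with k0(2) have k2: "2 ^ (a + 3) dvd k - 1"
    using cong_trans cong_iff_dvd_diff by blast
  have "(2::int) dvd 2 ^ (a + 3)"
    by simp
  with k2 have "2 dvd k - 1"
    using dvd_trans by blast
  hence "odd k"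
    by simp
  \<comment> \<open>Existence of \<open>n\<close>: \<open>k^2 - m^2 - 8 * r\<close> is divisible by
    8 because \<open>k\<close> and \<open>m\<close> are odd, by \<open>m^2\<close> by the choice of
    \<open>k\<close>, and the two divisors are coprime.\<close>
  have "[k\<^sup>2 = m\<^sup>2] (mod 8)"
    using odd_square_cong_1_mod_8 \<open>odd k\<close> \<open>odd m\<close> cong_sym cong_trans by blast
  hence "8 dvd (k\<^sup>2 - m\<^sup>2) - 8 * r"
    by (simp add: cong_iff_dvd_diff)
  moreover have "m\<^sup>2 dvd (k\<^sup>2 - 8 * r) - m\<^sup>2"
    using k8r by (simp add: cong_iff_dvd_diff)
  moreover have "coprime (8::int) (m\<^sup>2)"
    using \<open>odd m\<close> coprime_power_left_iff[of 2 3 "m\<^sup>2"] by simp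
  ultimately have "8 * m\<^sup>2 dvd k\<^sup>2 - m\<^sup>2 - 8 * r"
    by (intro divides_mult) (simp_all add: algebra_simps)
  then obtain n where n: "k\<^sup>2 - m\<^sup>2 - 8 * r = 8 * m\<^sup>2 * n" ..
  have "8 * r + m\<^sup>2 * (8 * b + 1) < k"
    using kL unfolding L_def by (smt (verit) zero_less_power)
  also have "\<dots> \<le> k\<^sup>2"
    using \<open>k > 0\<close> by (simp add: self_le_power)
  also have "\<dots> = 8 * r + m\<^sup>2 * (8 * n + 1)"
    using n by (simp add: algebra_simps)
  finally have "n > b"
    using \<open>m \<noteq> 0\<close> by simp
  moreover have "m\<^sup>2 * n + r \<noteq> 2 ^ a * p + m\<^sup>2 * triangular x" if "prime p" for p x
  proof
    assume eq: "m\<^sup>2 * n + r = 2 ^ a * p + m\<^sup>2 * triangular x"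
    define u where "u = m * (2 * x + 1)"
    have "odd u"
      using \<open>odd m\<close> by (simp add: u_def)
    obtain X where X: "k - u = 2 * X"
      using \<open>odd k\<close> \<open>odd u\<close> by (metis even_diff evenE odd_even_add)
    define Y where "Y = k - X"
    have Y: "k + u = 2 * Y"
      using X by (simp add: Y_def)
    have "8 * 2 ^ a * p = 8 * m\<^sup>2 * n + 8 * r - m\<^sup>2 * (8 * triangular x)"
      using eq by (simp add: algebra_simps)
    also have "\<dots> = k\<^sup>2 - u\<^sup>2"
      unfolding n[symmetric] eight_triangular u_def power_mult_distrib by (simp add: right_diff_distrib)
    also have "\<dots> = (k - u) * (k + u)"
      by (simp add: power2_eq_square algebra_simps)
    also have "\<dots> = 4 * (X * Y)"
      unfolding X Y by simp
    finally have XY: "X * Y = 2 ^ (a + 1) * p"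
      by (simp add: mult_ac)
    have sum: "X + Y = k"
      by (simp add: Y_def)
    \<comment> \<open>The sign of \<open>u\<close> is arbitrary, so either half
      \<open>(k - u) / 2\<close> or \<open>(k + u) / 2\<close> may be the odd one; the two cases are
      symmetric.\<close>
    have "odd X \<or> odd Y"
      using \<open>odd k\<close> sum by auto
    thus False
    proof
      assume "odd X"
      with XY sum show False
        using no_prime_factorization_odd[OF that, of X Y a] \<open>k > 0\<close> k2 np by simp
    next
      assume "odd Y"
      moreover have "Y * X = 2 ^ (a + 1) * p" "Y + X = k"
        using XY sum by (simp_all add: ac_simps)
      ultimately show False
        using no_prime_factorization_odd[OF that, of Y X a] \<open>k > 0\<close> k2 np by simp
    qed
  qed
  ultimately show ?thesis
    by blast
qed

section \<open>Unrepresented integers for an even modulus\<close>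

text \<open>With \<open>m = 2 * M\<close> the coefficient \<open>2 * m^2\<close> is
  \<open>8 * M^2\<close>. No power of 2 accompanies \<open>p\<close>, so the factors
  \<open>k - u\<close> and \<open>k + u\<close> need not be halved.\<close>

lemma unrepresented_unbounded_even:
  fixes M r y b :: int
  assumes "M > 0" and y: "[y\<^sup>2 = r + M\<^sup>2] (mod 8 * M\<^sup>2)"
  shows "\<exists>n>b. \<forall>p x. prime p \<longrightarrow> 8 * M\<^sup>2 * n + r \<noteq> p + 8 * M\<^sup>2 * triangular x"
proof -
  define D :: int where "D = 8 * M\<^sup>2"
  have D: "D > 0"
    using \<open>M > 0\<close> unfolding D_def by simp
  define L where "L = 1 + \<bar>r + M\<^sup>2 * (8 * b + 1)\<bar>"
  obtain k1 where k1: "[k1 = y] (mod D)" "k1 > L"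
    using cong_large_representative[OF D] by blast
  define c where "c = 2 * k1 - 1"
  \<comment> \<open>Chosen so that \<open>2 * k - 1\<close> becomes the proper product
    \<open>c * (2 * D + 1)\<close> while \<open>k\<close> stays congruent to \<open>y\<close> modulo
    \<open>D\<close>.\<close>
  define k where "k = k1 + D * c"
  have "c > 1"
    using k1(2) unfolding c_def L_def by linarith
  have kL: "k > L"
    unfolding k_def using k1(2) mult_pos_pos[of D c] D \<open>c > 1\<close> by linarith
  hence "k > 0"
    unfolding L_def by linarith
  have "2 * k - 1 = c * (2 * D + 1)"
    unfolding k_def c_def by (simp add: algebra_simps)
  hence np: "\<not> prime (2 * k - 1)"
    using not_prime_mult_int[of c "2 * D + 1"] D \<open>c > 1\<close> by simp
  have "[k = k1] (mod D)"
    by (simp add: cong_iff_dvd_diff k_def)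
  with k1(1) have "[k\<^sup>2 = y\<^sup>2] (mod D)"
    using cong_trans cong_pow by blast
  with y have "[k\<^sup>2 = r + M\<^sup>2] (mod D)"
    unfolding D_def using cong_trans by blast
  then obtain n where n: "k\<^sup>2 - (r + M\<^sup>2) = D * n"
    unfolding cong_iff_dvd_diff by (elim dvdE)
  have "r + M\<^sup>2 * (8 * b + 1) < k"
    using kL unfolding L_def by linarith
  also have "\<dots> \<le> k\<^sup>2"
    using \<open>k > 0\<close> by (simp add: self_le_power)
  also have "\<dots> = r + M\<^sup>2 * (8 * n + 1)"
    using n by (simp add: algebra_simps D_def)
  finally have "n > b"
    using \<open>M > 0\<close> by simp
  moreover have "8 * M\<^sup>2 * n + r \<noteq> p + 8 * M\<^sup>2 * triangular x" if "prime p" for p x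
  proof
    assume eq: "8 * M\<^sup>2 * n + r = p + 8 * M\<^sup>2 * triangular x"
    define u where "u = M * (2 * x + 1)"
    have "p = D * n + r - M\<^sup>2 * (8 * triangular x)"
      using eq by (simp add: algebra_simps D_def)
    also have "\<dots> = k\<^sup>2 - u\<^sup>2"
      unfolding n[symmetric] eight_triangular u_def power_mult_distrib by (simp add: right_diff_distrib)
    also have "\<dots> = (k - u) * (k + u)"
      by (simp add: power2_eq_square algebra_simps)
    finally have p: "p = (k - u) * (k + u)" .
    hence "k - u > 0" "k + u > 0"
      using pos_factors_if_pos_sum[of "k - u" "k + u"] \<open>k > 0\<close> prime_gt_0_int[OF that] by auto
    with not_prime_mult_int[of "k - u" "k + u"] that p have "k - u = 1 \<or> k + u = 1"
      by fastforce
    \<comment> \<open>The factors sum to \<open>2 * k\<close>, so if one is 1 the other is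
      \<open>2 * k - 1\<close>.\<close>
    hence "p = 2 * k - 1"
      using p by auto
    with that np show False
      by simp
  qed
  ultimately show ?thesis
    by blast
qed

text \<open>By the Chinese remainder theorem it suffices to solve modulo \<open>m0^2\<close>, where
  \<open>M^2\<close> vanishes and a root of \<open>r\<close> lifts, and modulo
  \<open>2 ^ (2 * \<beta> + 3)\<close>.\<close>

lemma square_root_exists_even:
  fixes m0 r :: int
  assumes "odd m0" "quad_residue m0 r"
    and r: "[r = 2 ^ (\<beta> + 1) + 1] (mod 2 ^ min (\<beta> + 2) 3)"
  shows "\<exists>y. [y\<^sup>2 = r + (2 ^ \<beta> * m0)\<^sup>2] (mod 8 * (2 ^ \<beta> * m0)\<^sup>2)"
proof -
  define M where "M = 2 ^ \<beta> * m0"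
  obtain y1 where y1: "[y1\<^sup>2 = r] (mod m0\<^sup>2)"
    using quad_residue_lift_square assms by blast
  have m0: "[m0\<^sup>2 = 1] (mod 8)"
    using odd_square_cong_1_mod_8 \<open>odd m0\<close> .
  have "\<exists>y. [y\<^sup>2 = r + M\<^sup>2] (mod 2 ^ (2 * \<beta> + 3))"
  proof (cases "\<beta> = 0")
    case True
    \<comment> \<open>Only \<open>r\<close> modulo 4 is known, so \<open>r + M^2\<close> is 0 or 4
      modulo 8; the roots 0 and 2 serve these cases.\<close>
    hence "[r = 3] (mod 4)"
      using r by simp
    then obtain t where t: "r = 3 + 4 * t"
      by (metis cong_iff_lin cong_sym)
    have "[r + M\<^sup>2 = 4 + 4 * t] (mod 8)"
      using cong_add[OF cong_refl m0, of r] True t by (simp add: M_def)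
    moreover have "[(if even t then 2 else 0)\<^sup>2 = 4 + 4 * t] (mod 8)"
      by (auto simp: cong_iff_dvd_diff elim!: evenE oddE)
    ultimately have "[(if even t then 2 else 0)\<^sup>2 = r + M\<^sup>2] (mod 8)"
      using cong_sym cong_trans by blast
    thus ?thesis
      unfolding True by auto
  next
    case False
    then obtain \<gamma> where \<gamma>: "\<beta> = Suc \<gamma>"
      using not0_implies_Suc by blast
    have "[r = 4 * 2 ^ \<gamma> + 1] (mod 8)"
      using r by (simp add: \<gamma>)
    moreover have "[M\<^sup>2 = 4 * (2 ^ \<gamma>)\<^sup>2 * 1] (mod 8)"
      using cong_mult[OF cong_refl m0, of "4 * (2 ^ \<gamma>)\<^sup>2"]
      by (simp add: M_def \<gamma> power_mult_distrib)
    ultimately have "[r + M\<^sup>2 = (4 * 2 ^ \<gamma> + 1) + 4 * (2 ^ \<gamma>)\<^sup>2 * 1] (mod 8)"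
      by (rule cong_add)
    \<comment> \<open>With \<open>h = 2 ^ \<gamma>\<close>, the terms \<open>4 * h + 4 * h^2\<close>
      are eight times a triangular number, so \<open>r + M^2\<close> is 1 modulo 8 and thus a square
      modulo every power of 2.\<close>
    moreover have "[(4 * 2 ^ \<gamma> + 1) + 4 * (2 ^ \<gamma>)\<^sup>2 * 1 = (1::int)] (mod 8)"
    proof -
      have "(4 * 2 ^ \<gamma> + 1) + 4 * (2 ^ \<gamma>)\<^sup>2 * 1 - 1 = 8 * triangular (2 ^ \<gamma>)"
        by (simp add: eight_triangular power2_eq_square algebra_simps)
      thus ?thesis
        by (simp add: cong_iff_dvd_diff)
    qed
    ultimately have "[r + M\<^sup>2 = 1] (mod 8)"
      by (rule cong_trans)
    thus ?thesis
      using square_mod_power_of_2 by blast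
  qed
  then obtain y2 where y2: "[y2\<^sup>2 = r + M\<^sup>2] (mod 2 ^ (2 * \<beta> + 3))"
    by blast
  have cop: "coprime (m0\<^sup>2) (2 ^ (2 * \<beta> + 3))"
    using \<open>odd m0\<close> by simp
  then obtain y where y: "[y = y1] (mod m0\<^sup>2)" "[y = y2] (mod 2 ^ (2 * \<beta> + 3))"
    using binary_chinese_remainder_int by blast
  have "[y\<^sup>2 = r + M\<^sup>2] (mod m0\<^sup>2)"
  proof -
    have "[y\<^sup>2 = r] (mod m0\<^sup>2)"
      using y(1) y1 cong_pow cong_trans by blast
    moreover have "[M\<^sup>2 = 0] (mod m0\<^sup>2)"
      by (simp add: M_def cong_0_iff power_mult_distrib)
    ultimately show ?thesis
      using cong_add[of "y\<^sup>2" r "m0\<^sup>2" 0 "M\<^sup>2"] cong_sym by fastforce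
  qed
  moreover have "[y\<^sup>2 = r + M\<^sup>2] (mod 2 ^ (2 * \<beta> + 3))"
    using y(2) y2 cong_pow cong_trans by blast
  ultimately have "[y\<^sup>2 = r + M\<^sup>2] (mod m0\<^sup>2 * 2 ^ (2 * \<beta> + 3))"
    using coprime_cong_mult cop by blast
  moreover have "m0\<^sup>2 * 2 ^ (2 * \<beta> + 3) = 8 * M\<^sup>2"
    by (simp add: M_def power_mult_distrib power_add power_even_eq)
  ultimately show ?thesis
    unfolding M_def by metis
qed

section \<open>From unbounded families to infinite sets\<close>

lemma rat_eq_divide_add_iff:
  fixes n q r d t :: int
  assumes "d \<noteq> 0"
  shows "rat_of_int n = (rat_of_int q - rat_of_int r) / rat_of_int d + rat_of_int t
    \<longleftrightarrow> d * n + r = q + d * t"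
proof -
  have "rat_of_int n = (rat_of_int q - rat_of_int r) / rat_of_int d + rat_of_int t
    \<longleftrightarrow> rat_of_int (d * n + r) = rat_of_int (q + d * t)"
    using assms by (auto simp: field_simps)
  thus ?thesis
    by (simp only: of_int_eq_iff)
qed

text \<open>Covers both parts: \<open>d = m^2\<close>, \<open>q = 2 ^ a\<close> in the odd case and
  \<open>d = 2 * m^2\<close>, \<open>q = 1\<close> in the even case.\<close>

lemma infinite_unrepresented:
  fixes d r q :: int
  assumes "d > 0"
    and unb: "\<And>b. \<exists>n>b. \<forall>p x. prime p \<longrightarrow> d * n + r \<noteq> q * p + d * triangular x"
  shows "infinite {n::int. n > 0 \<and> \<not> (\<exists>(p::int) (x::int). prime p \<and>
           rat_of_int n = (rat_of_int q * rat_of_int p - rat_of_int r) / rat_of_int d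
             + rat_of_int (triangular x))}"
proof (rule infinite_int_if_unbounded)
  fix b
  obtain n where "n > max b 0" "\<forall>p x. prime p \<longrightarrow> d * n + r \<noteq> q * p + d * triangular x"
    using unb by blast
  thus "\<exists>n\<in>{n::int. n > 0 \<and> \<not> (\<exists>(p::int) (x::int). prime p \<and>
           rat_of_int n = (rat_of_int q * rat_of_int p - rat_of_int r) / rat_of_int d
             + rat_of_int (triangular x))}. n > b"
    using rat_eq_divide_add_iff[of d n "q * _" r] \<open>d > 0\<close> by (intro bexI[of _ n]) auto
qed

text \<open>The members are the numbers \<open>d * n + r\<close> with \<open>n\<close> positive:
  they exceed \<open>d\<close> and inherit coprimality to \<open>d\<close> from
  \<open>r\<close>.\<close>

lemma infinite_coprime_unrepresented:
  fixes d r q :: int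
  assumes "d > 0" "r > 0" "coprime d r"
    and unb: "\<And>b. \<exists>n>b. \<forall>p x. prime p \<longrightarrow> d * n + r \<noteq> q * p + d * triangular x"
  shows "infinite {n::int. n > d \<and> gcd d n = 1 \<and>
           (\<forall>(p::int) (x::int). prime p \<longrightarrow> n \<noteq> q * p + d * triangular x)}"
proof (rule infinite_int_if_unbounded)
  fix b
  obtain n where n: "n > max b 0" "\<forall>p x. prime p \<longrightarrow> d * n + r \<noteq> q * p + d * triangular x"
    using unb by blast
  have "1 * n \<le> d * n" "d * 1 \<le> d * n"
    using \<open>d > 0\<close> n(1) by (intro mult_right_mono mult_left_mono; simp)+
  hence "d * n + r > b" "d * n + r > d"
    using n(1) \<open>r > 0\<close> by linarith+
  moreover have "gcd d (d * n + r) = 1"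
    using \<open>coprime d r\<close> by (metis add.commute coprime_iff_gcd_eq_1 gcd_add_mult mult.commute)
  ultimately show "\<exists>n\<in>{n::int. n > d \<and> gcd d n = 1 \<and>
           (\<forall>(p::int) (x::int). prime p \<longrightarrow> n \<noteq> q * p + d * triangular x)}. n > b"
    using n(2) by (intro bexI[of _ "d * n + r"]) simp_all
qed

section \<open>Assembling the two parts\<close>

lemma unrepresented_unbounded_double_square:
  fixes m m0 r b :: int
  assumes "\<alpha> > 0" "m0 > 0" "odd m0" "m = 2 ^ \<alpha> * m0"
    and "quad_residue m0 r" "[r = 2 ^ \<alpha> + 1] (mod 2 ^ min (\<alpha> + 1) 3)"
  shows "\<exists>n>b. \<forall>p x. prime p \<longrightarrow> 2 * m\<^sup>2 * n + r \<noteq> 1 * p + 2 * m\<^sup>2 * triangular x"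
proof -
  obtain \<beta> where \<beta>: "\<alpha> = Suc \<beta>"
    using \<open>\<alpha> > 0\<close> gr0_implies_Suc by blast
  define M where "M = 2 ^ \<beta> * m0"
  have "M > 0"
    using assms by (simp add: M_def)
  obtain y where "[y\<^sup>2 = r + M\<^sup>2] (mod 8 * M\<^sup>2)"
    using square_root_exists_even[of m0 r \<beta>] assms unfolding M_def \<beta> by auto
  from unrepresented_unbounded_even[OF \<open>M > 0\<close> this, of b]
  show ?thesis
    using assms(4) by (simp add: \<beta> M_def power_mult_distrib mult.assoc)
qed

theorem theorem1p2:
  shows
    "(\<forall>(m::int) (a::nat). m > 1 \<and> odd m \<longrightarrow>
        (\<forall>r::int. r > 0 \<and> quad_residue m (2 * r) \<longrightarrow>
          infinite {n::int. n > 0 \<and>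
            \<not> (\<exists>(p::int) (x::int). prime p \<and>
                 rat_of_int n = (2 ^ a * rat_of_int p - rat_of_int r) / (rat_of_int m)\<^sup>2
                                + rat_of_int (triangular x))})
        \<and> infinite {n::int. n > m\<^sup>2 \<and> gcd (m\<^sup>2) n = 1 \<and>
            (\<forall>(p::int) (x::int). prime p \<longrightarrow> n \<noteq> 2 ^ a * p + m\<^sup>2 * triangular x)})
     \<and>
     (\<forall>(m::int) (\<alpha>::nat) (m0::int). \<alpha> > 0 \<and> m0 > 0 \<and> odd m0 \<and> m = 2 ^ \<alpha> * m0 \<longrightarrow>
        (\<forall>r::int. r > 0 \<and> quad_residue m0 r \<and> [r = 2 ^ \<alpha> + 1] (mod 2 ^ min (\<alpha> + 1) 3) \<longrightarrow>
          infinite {n::int. n > 0 \<and>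
            \<not> (\<exists>(p::int) (x::int). prime p \<and>
                 rat_of_int n = (rat_of_int p - rat_of_int r) / (2 * (rat_of_int m)\<^sup>2)
                                + rat_of_int (triangular x))})
        \<and> infinite {n::int. n > 2 * m\<^sup>2 \<and> gcd (2 * m\<^sup>2) n = 1 \<and>
            (\<forall>(p::int) (x::int). prime p \<longrightarrow> n \<noteq> p + 2 * m\<^sup>2 * triangular x)})"
proof (intro conjI allI impI; (elim conjE)?)
  fix m r :: int and a :: nat
  assume m: "m > 1" "odd m" and r: "r > 0" "quad_residue m (2 * r)"
  obtain y where "[y\<^sup>2 = 2 * r] (mod m\<^sup>2)"
    using quad_residue_lift_square m r by blast
  \<comment> \<open>Doubling the root of \<open>2 * r\<close> gives the required root of
    \<open>8 * r\<close>.\<close>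
  hence "[4 * y\<^sup>2 = 4 * (2 * r)] (mod m\<^sup>2)"
    by (intro cong_mult cong_refl)
  hence "[(2 * y)\<^sup>2 = 8 * r] (mod m\<^sup>2)"
    by (simp add: power_mult_distrib)
  from infinite_unrepresented[OF _ unrepresented_unbounded_odd[OF m(2) this, of _ a]] m(1)
  show "infinite {n::int. n > 0 \<and>
            \<not> (\<exists>(p::int) (x::int). prime p \<and>
                 rat_of_int n = (2 ^ a * rat_of_int p - rat_of_int r) / (rat_of_int m)\<^sup>2
                                + rat_of_int (triangular x))}"
    by simp
next
  fix m :: int and a :: nat
  assume m: "m > 1" "odd m"
  \<comment> \<open>The choice \<open>r = 2\<close> works for every odd \<open>m\<close>:
    \<open>8 * r\<close> is the square of 4, and 2 is coprime to \<open>m^2\<close>.\<close>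
  have "[4\<^sup>2 = 8 * 2] (mod m\<^sup>2)"
    by simp
  from unrepresented_unbounded_odd[OF m(2) this, of _ a]
  show "infinite {n::int. n > m\<^sup>2 \<and> gcd (m\<^sup>2) n = 1 \<and>
            (\<forall>(p::int) (x::int). prime p \<longrightarrow> n \<noteq> 2 ^ a * p + m\<^sup>2 * triangular x)}"
    by (rule infinite_coprime_unrepresented[rotated 3]) (use m in auto)
next
  fix m m0 r :: int and \<alpha> :: nat
  assume m: "\<alpha> > 0" "m0 > 0" "odd m0" "m = 2 ^ \<alpha> * m0"
    and r: "r > 0" "quad_residue m0 r" "[r = 2 ^ \<alpha> + 1] (mod 2 ^ min (\<alpha> + 1) 3)"
  from unrepresented_unbounded_double_square[OF m r(2,3)]
  have "infinite {n::int. n > 0 \<and> \<not> (\<exists>(p::int) (x::int). prime p \<and>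
           rat_of_int n = (rat_of_int 1 * rat_of_int p - rat_of_int r) / rat_of_int (2 * m\<^sup>2)
             + rat_of_int (triangular x))}"
    by (intro infinite_unrepresented) (use m in auto)
  thus "infinite {n::int. n > 0 \<and>
            \<not> (\<exists>(p::int) (x::int). prime p \<and>
                 rat_of_int n = (rat_of_int p - rat_of_int r) / (2 * (rat_of_int m)\<^sup>2)
                                + rat_of_int (triangular x))}"
    by simp
next
  fix m m0 :: int and \<alpha> :: nat
  assume m: "\<alpha> > 0" "m0 > 0" "odd m0" "m = 2 ^ \<alpha> * m0"
  \<comment> \<open>The choice \<open>r = m + 1\<close> is 1 modulo \<open>m0\<close>, is coprime to
    \<open>2 * m^2\<close> since \<open>m\<close> is even, and has the required residue because
    \<open>m - 2 ^ \<alpha>\<close> is a multiple of \<open>2 ^ (\<alpha> + 1)\<close>.\<close>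
  have "quad_residue m0 (m + 1)"
    unfolding quad_residue_def by (rule exI[of _ 1]) (simp add: m cong_iff_dvd_diff)
  moreover have "[m + 1 = 2 ^ \<alpha> + 1] (mod 2 ^ min (\<alpha> + 1) 3)"
  proof -
    obtain t where "m0 = 2 * t + 1"
      using m(3) by (elim oddE)
    hence "(m + 1) - (2 ^ \<alpha> + 1) = 2 ^ (\<alpha> + 1) * t"
      using m(4) by (simp add: algebra_simps)
    moreover have "(2::int) ^ min (\<alpha> + 1) 3 dvd 2 ^ (\<alpha> + 1)"
      by (intro le_imp_power_dvd) simp
    ultimately show ?thesis
      by (simp only: cong_iff_dvd_diff dvd_mult2)
  qed
  ultimately have unb: "\<exists>n>b. \<forall>p x. prime p \<longrightarrow>
      2 * m\<^sup>2 * n + (m + 1) \<noteq> 1 * p + 2 * m\<^sup>2 * triangular x" for b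
    using unrepresented_unbounded_double_square[OF m] by blast
  have "even m" "m > 0"
    using m by auto
  hence "coprime (2 * m\<^sup>2) (m + 1)"
    by (simp add: coprime_commute)
  with \<open>m > 0\<close> have "infinite {n::int. n > 2 * m\<^sup>2 \<and> gcd (2 * m\<^sup>2) n = 1 \<and>
            (\<forall>(p::int) (x::int). prime p \<longrightarrow> n \<noteq> 1 * p + 2 * m\<^sup>2 * triangular x)}"
    by (intro infinite_coprime_unrepresented[OF _ _ _ unb]) auto
  thus "infinite {n::int. n > 2 * m\<^sup>2 \<and> gcd (2 * m\<^sup>2) n = 1 \<and>
            (\<forall>(p::int) (x::int). prime p \<longrightarrow> n \<noteq> p + 2 * m\<^sup>2 * triangular x)}"
    by simp
qed

end
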